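(* Any round systolic complex $\mathbf X$ has diameter at most $2$.
   Context: All graphs are nonempty, undirected, connected, without loops or multiple edges. A simplicial complex is flag if every set of vertices, each pair of which lies in a common simplex, is contained in a simplex. A graph is bridged if it contains no isometric cycle of length greater than $3$ (an isometric subgraph is an induced subgraph in which distances coincide with those of the whole graph). A systolic complex is a flag simplicial complex whose $1$-skeleton is a (connected) bridged graph; equivalently, a simply connected simplicial complex in which the links of vertices are flag complexes without induced $4$- and $5$-cycles. The diameter of $\mathbf X$ and its balls $B_r(v)$ (vertices at distance at most $r$ from $v$) are those of its $1$-skeleton with the path metric. A systolic complex $\mathbf X$ of finite diameter $k$ is round if $\bigcap\{B_{k-1}(v): v\in V(\mathbf X)\}=\emptyset$. *)

theory Defs
  imports Main "HOL-Library.Extended_Nat"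
begin

(* A graph is given by its vertex set V and a symmetric, irreflexive edge relation E on V.
   Neither V nor the vertex degrees are required to be finite. *)

definition connected_graph :: "'a set \<Rightarrow> 'a rel \<Rightarrow> bool" where
  "connected_graph V E \<longleftrightarrow>
     V \<noteq> {} \<and> E \<subseteq> V \<times> V \<and> sym E \<and> irrefl E \<and> (\<forall>u\<in>V. \<forall>v\<in>V. (u, v) \<in> E\<^sup>*)"

(* Path metric: E ^^ n relates the endpoints of the walks of length n, so this is the length
   of a shortest path; it is \<infinity> (the infimum of the empty set) if there is no path. *)
definition graph_dist :: "'a rel \<Rightarrow> 'a \<Rightarrow> 'a \<Rightarrow> enat" where
  "graph_dist E u v = (INF n\<in>{n. (u, v) \<in> E ^^ n}. enat n)"

definition graph_diameter :: "'a set \<Rightarrow> 'a rel \<Rightarrow> enat" where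
  "graph_diameter V E = (SUP u\<in>V. SUP v\<in>V. graph_dist E u v)"

(* The radius is an integer, so that the radius k - 1 is not truncated for k = 0:
   balls of negative radius are empty. *)
definition graph_ball :: "'a set \<Rightarrow> 'a rel \<Rightarrow> int \<Rightarrow> 'a \<Rightarrow> 'a set" where
  "graph_ball V E r v = {u \<in> V. \<exists>n. graph_dist E v u = enat n \<and> int n \<le> r}"

definition induced_edges :: "'a rel \<Rightarrow> 'a set \<Rightarrow> 'a rel" where
  "induced_edges E W = E \<inter> (W \<times> W)"

definition isometric_subgraph :: "'a set \<Rightarrow> 'a rel \<Rightarrow> 'a set \<Rightarrow> bool" where
  "isometric_subgraph V E W \<longleftrightarrow>
     W \<subseteq> V \<and> (\<forall>u\<in>W. \<forall>v\<in>W. graph_dist (induced_edges E W) u v = graph_dist E u v)"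

definition is_cycle :: "'a set \<Rightarrow> 'a rel \<Rightarrow> nat \<Rightarrow> bool" where
  "is_cycle W F n \<longleftrightarrow> n \<ge> 3 \<and>
     (\<exists>c. bij_betw c {..<n} W \<and>
          F = {(c i, c j) | i j. i < n \<and> j < n \<and> (j = (i + 1) mod n \<or> i = (j + 1) mod n)})"

definition bridged_graph :: "'a set \<Rightarrow> 'a rel \<Rightarrow> bool" where
  "bridged_graph V E \<longleftrightarrow> connected_graph V E \<and>
     \<not> (\<exists>W n. n > 3 \<and> isometric_subgraph V E W \<and> is_cycle W (induced_edges E W) n)"

(* An abstract simplicial complex is the set of its (nonempty, finite) simplices. *)

definition simplicial_complex :: "'a set set \<Rightarrow> bool" where
  "simplicial_complex X \<longleftrightarrow>
     (\<forall>\<sigma>\<in>X. finite \<sigma> \<and> \<sigma> \<noteq> {}) \<and> (\<forall>\<sigma>\<in>X. \<forall>\<tau>. \<tau> \<subseteq> \<sigma> \<and> \<tau> \<noteq> {} \<longrightarrow> \<tau> \<in> X)"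

definition vertices :: "'a set set \<Rightarrow> 'a set" where
  "vertices X = \<Union>X"

definition skeleton_edges :: "'a set set \<Rightarrow> 'a rel" where
  "skeleton_edges X = {(u, v). u \<noteq> v \<and> {u, v} \<in> X}"

(* W ranges over arbitrary sets of vertices. As simplices are finite, a flag complex
   has no infinite set of pairwise adjacent vertices. *)
definition flag_complex :: "'a set set \<Rightarrow> bool" where
  "flag_complex X \<longleftrightarrow>
     (\<forall>W \<subseteq> vertices X. (\<forall>u\<in>W. \<forall>v\<in>W. \<exists>\<sigma>\<in>X. {u, v} \<subseteq> \<sigma>) \<longrightarrow> (\<exists>\<sigma>\<in>X. W \<subseteq> \<sigma>))"

definition systolic_complex :: "'a set set \<Rightarrow> bool" where
  "systolic_complex X \<longleftrightarrow>
     simplicial_complex X \<and> flag_complex X \<and> bridged_graph (vertices X) (skeleton_edges X)"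

definition complex_diameter :: "'a set set \<Rightarrow> enat" where
  "complex_diameter X = graph_diameter (vertices X) (skeleton_edges X)"

definition complex_ball :: "'a set set \<Rightarrow> int \<Rightarrow> 'a \<Rightarrow> 'a set" where
  "complex_ball X r v = graph_ball (vertices X) (skeleton_edges X) r v"

definition round_systolic_complex :: "'a set set \<Rightarrow> bool" where
  "round_systolic_complex X \<longleftrightarrow> systolic_complex X \<and>
     (\<exists>k::nat. complex_diameter X = enat k \<and>
        (\<Inter>v\<in>vertices X. complex_ball X (int k - 1) v) = {})"

end

theory Submission
  imports Defs
begin

text \<open>Suppose that the diameter k is at least 3. In a bridged graph, two neighbours of x that are
  closer to v than x are equal or adjacent, and adjacent vertices equidistant from v have a common
  neighbour closer to v. It follows that balls, and neighbourhoods of convex sets, are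
  convex. Since there are no infinite cliques, a compactness argument provides a finite set F such
  that every vertex is at distance k from some vertex of F. Minimality arguments as for Helly's theorem
  then yield a triangle, each vertex of which is at distance k from a vertex that is closer to the
  other two. For k at least 3 such a triangle forces an induced cycle of length 4 or 5.\<close>

section \<open>Weak modularity\<close>

text \<open>The minimality arguments count antipodes, and the vertex set may be infinite; that is
  why they are run inside a finite set \<open>F\<close> before compactness is used. No vertex degree
  is bounded either, so compactness has to come from the cliques that convex sets cut out around a
  point. The number 3 is used where, starting from an edge of the triangle at distance k - 1 from an
  antipode, one descends twice towards that antipode, to distances k - 2 and k - 3. Distances are
  taken on the whole type, which spares membership conditions throughout; in return
  \<open>d x y = 0\<close> does not give \<open>x = y\<close>, so points at distance 0 are treated
  separately in many proofs. A vertex of \<open>V\<close> is demanded in \<open>d_step\<close>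
  because cliques are only known to be finite inside \<open>V\<close>.\<close>

locale graph_metric =
  fixes V :: "'a set" and d :: "'a \<Rightarrow> 'a \<Rightarrow> nat"
  assumes d_refl [simp]: "d x x = 0"
    and d_sym: "d x y = d y x"
    and d_tri: "d x z \<le> d x y + d y z"
    and d_step: "d x y = Suc n \<Longrightarrow> \<exists>z\<in>V. d x z = 1 \<and> d z y = n"
begin

lemma d_tri1: "d y z \<le> 1 \<Longrightarrow> d x z \<le> Suc (d x y)"
  using d_tri[of x z y] by simp


lemma Lipschitz_walk:
  assumes "\<And>i. d (c i) (c (Suc i)) \<le> 1"
  shows "d (c i) (c (i + l)) \<le> l"
proof (induction l)
  case (Suc l)
  then show ?case using d_tri1[OF assms[of "i + l"], of "c i"] by simp
qed simp

text \<open>A subwalk of a geodesic is a geodesic, so arcs of length at most \<open>n\<close>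
  realise distances. As \<open>m \<le> 2 * n + 1\<close>, one of the two arcs between any two points
  is that short.\<close>

lemma isometric_closed_walk:
  assumes step: "\<And>i. d (c i) (c (Suc i)) \<le> 1" and per: "\<And>i. c (i + m) = c i"
    and anti: "\<And>i. d (c i) (c (i + n)) = n" and m: "m \<le> 2 * n + 1" and ij: "i \<le> j" "j < i + m"
  shows "d (c i) (c j) = min (j - i) (m - (j - i))"
proof -
  have short: "d (c a) (c (a + l)) = l" if "l \<le> n" for a l
    using Lipschitz_walk[of c a l] Lipschitz_walk[of c "a + l" "n - l"] step
      d_tri[of "c a" "c (a + n)" "c (a + l)"] anti[of a] that by simp
  show ?thesis
  proof (cases "j - i \<le> n")
    case True
    then have "d (c i) (c j) = j - i" using short[of "j - i" i] ij by simp
    then show ?thesis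
    proof (cases "j - i \<le> m - (j - i)")
      case False
      then have "m - (j - i) \<le> n" using True by simp
      from short[OF this, of j] have "d (c j) (c i) = m - (j - i)" using ij per[of i] by (simp add: add.commute)
      then show ?thesis using d_sym[of "c i" "c j"] \<open>d (c i) (c j) = j - i\<close> False by simp
    qed simp
  next
    case False
    then have "m - (j - i) \<le> n" using m by simp
    from short[OF this, of j] have "d (c j) (c i) = m - (j - i)" using ij per[of i] by (simp add: add.commute)
    moreover have "m - (j - i) \<le> j - i" using False m by simp
    ultimately show ?thesis using d_sym[of "c i" "c j"] by simp
  qed
qed

text \<open>Steps of length 0 are allowed so that a walk can be padded to a prescribed
  length.\<close>

lemma walk_exists:
  assumes "d x y \<le> Suc n"
  shows "\<exists>p. p 0 = x \<and> p (Suc n) = y \<and> (\<forall>i\<le>n. d (p i) (p (Suc i)) \<le> 1)"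
  using assms
proof (induction n arbitrary: x)
  case 0
  then show ?case by (intro exI[of _ "\<lambda>i. if i = 0 then x else y"]) auto
next
  case (Suc n)
  obtain z where z: "d x z \<le> 1" "d z y \<le> Suc n"
  proof (cases "d x y = 0")
    case True
    then show ?thesis using that[of x] by simp
  next
    case False
    then obtain k where k: "d x y = Suc k" using not0_implies_Suc by blast
    from d_step[OF this] obtain z where "d x z = 1" "d z y = k" by blast
    then show ?thesis using that[of z] k Suc.prems by simp
  qed
  obtain p where p: "p 0 = z" "p (Suc n) = y" "\<forall>i\<le>n. d (p i) (p (Suc i)) \<le> 1"
    using Suc.IH[OF z(2)] by blast
  show ?case
    by (intro exI[of _ "\<lambda>i. if i = 0 then x else p (i - 1)"])
      (use p z in \<open>auto simp: Suc_le_eq gr0_conv_Suc\<close>)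
qed

text \<open>Indices run over all natural numbers, so that turning the walk becomes a shift of the
  index. The step from \<open>P a\<close> to \<open>Q 0\<close> takes one extra index, while
  \<open>Q b\<close> falls on index 0 modulo the period and is \<open>P 0\<close>.\<close>

lemma closed_walk_exists:
  assumes P: "\<And>i. i < a \<Longrightarrow> d (P i) (P (Suc i)) \<le> 1" and Q: "\<And>i. i < b \<Longrightarrow> d (Q i) (Q (Suc i)) \<le> 1"
    and PQ: "d (P a) (Q 0) \<le> 1" and QP: "Q b = P 0"
  obtains c where "\<And>i. d (c i) (c (Suc i)) \<le> 1" "\<And>i. c (i + (a + b + 1)) = c i"
    "\<And>i. i \<le> a \<Longrightarrow> c i = P i" "\<And>i. i \<le> b \<Longrightarrow> c (a + 1 + i) = Q i"
proof -
  define m where "m = a + b + 1"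
  define c where "c = (\<lambda>i. if i mod m \<le> a then P (i mod m) else Q (i mod m - a - 1))"
  have "d (c i) (c (Suc i)) \<le> 1" for i
  proof -
    define k where "k = i mod m"
    have k: "k < m" "Suc i mod m = (if Suc k = m then 0 else Suc k)"
      by (simp_all add: k_def m_def mod_Suc)
    consider "k < a" "Suc k \<noteq> m" | "k = a" "Suc k \<noteq> m" | "k = a" "Suc k = m" | "k > a" "Suc k \<noteq> m" | "k > a" "Suc k = m"
      using k(1) m_def by linarith
    then show ?thesis
    proof cases
      case 4
      then have "Suc k - a - 1 = Suc (k - a - 1)" "k - a - 1 < b" using k(1) m_def by auto
      with Q[of "k - a - 1"] 4 show ?thesis unfolding c_def k(2) k_def[symmetric] by auto
    next
      case 5
      then have "Suc (k - a - 1) = b" using m_def by auto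
      with Q[of "k - a - 1"] 5 QP show ?thesis unfolding c_def k(2) k_def[symmetric] by auto
    qed (unfold c_def k(2) k_def[symmetric], use P PQ QP m_def in auto)
  qed
  moreover have "c (i + (a + b + 1)) = c i" for i
    unfolding c_def m_def[symmetric] by simp
  moreover have "c i = P i" if "i \<le> a" for i
    using that by (simp add: c_def m_def)
  moreover have "c (a + 1 + i) = Q i" if "i \<le> b" for i
  proof (cases "i = b")
    case True
    then have "(a + 1 + i) mod m = 0" by (simp add: m_def)
    then show ?thesis using True QP by (simp add: c_def)
  next
    case False
    then have "(a + 1 + i) mod m = a + 1 + i" using that by (simp add: m_def)
    then show ?thesis by (simp add: c_def)
  qed
  ultimately show thesis by (rule that)
qed

end

locale bridged_metric = graph_metric +
  assumes no_isometric_cycle: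
    "3 < n \<Longrightarrow> (\<And>i j. i \<le> j \<Longrightarrow> j < n \<Longrightarrow> d (c i) (c j) = min (j - i) (n - (j - i))) \<Longrightarrow> False"
begin

text \<open>The triangle inequality turns each bound 2 into an equality, so the five vertices form
  an isometric cycle.\<close>

lemma no_pentagon:
  assumes "d a b = 1" "d b e = 1" "d e f = 1" "d f g = 1" "d g a = 1"
    and "2 \<le> d a e" "2 \<le> d b f" "2 \<le> d e g" "2 \<le> d f a" "2 \<le> d g b"
  shows False
proof -
  let ?c = "\<lambda>i::nat. [a, b, e, f, g] ! i"
  have two: "d a e = 2" "d b f = 2" "d e g = 2" "d a f = 2" "d b g = 2"
    using assms d_tri[of a e b] d_tri[of b f e] d_tri[of e g f] d_tri[of f a g] d_tri[of g b a]
      d_sym[of a f] d_sym[of b g] by simp_all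
  have sym: "d a g = 1" using assms(5) d_sym by simp
  show False
  proof (rule no_isometric_cycle[of 5 ?c])
    fix i j :: nat
    assume "i \<le> j" "j < 5"
    then have "j \<in> {0,1,2,3,4}" "i \<in> {0,1,2,3,4}" by auto
    with \<open>i \<le> j\<close> show "d (?c i) (?c j) = min (j - i) (5 - (j - i))"
      using assms two sym by (auto simp: eval_nat_numeral)
  qed simp
qed

text \<open>The counterpart of the quadrangle condition of weakly modular graphs: without induced
  4-cycles, that condition forces \<open>u\<close> and \<open>w\<close> to be adjacent. The index is
  the distance of \<open>x\<close> minus 1; both conditions are proved by one induction on it, in
  which \<open>triangle_condition n\<close> also uses \<open>interval_condition n\<close>.\<close>

definition interval_condition :: "nat \<Rightarrow> bool" where
  "interval_condition n \<longleftrightarrow> (\<forall>v x u w. d v x = Suc n \<longrightarrow> d v u \<le> n \<longrightarrow> d v w \<le> n \<longrightarrow>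
     d x u \<le> 1 \<longrightarrow> d x w \<le> 1 \<longrightarrow> d u w \<le> 1)"

definition triangle_condition :: "nat \<Rightarrow> bool" where
  "triangle_condition n \<longleftrightarrow> (\<forall>v u w. d v u = Suc n \<longrightarrow> d v w = Suc n \<longrightarrow> d u w \<le> 1 \<longrightarrow>
     (\<exists>t. d v t = n \<and> d t u = 1 \<and> d t w = 1))"

lemma interval_conditionD:
  "interval_condition n \<Longrightarrow> d v x = Suc n \<Longrightarrow> d v u \<le> n \<Longrightarrow> d v w \<le> n \<Longrightarrow> d u x \<le> 1 \<Longrightarrow> d w x \<le> 1
    \<Longrightarrow> d u w \<le> 1"
  unfolding interval_condition_def using d_sym by metis

lemma triangle_conditionD:
  "triangle_condition n \<Longrightarrow> d v u = Suc n \<Longrightarrow> d v w = Suc n \<Longrightarrow> d u w \<le> 1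
    \<Longrightarrow> (\<And>t. d v t = n \<Longrightarrow> d t u = 1 \<Longrightarrow> d t w = 1 \<Longrightarrow> thesis) \<Longrightarrow> thesis"
  unfolding triangle_condition_def by blast

text \<open>A violation of the interval or the triangle condition lives on a closed walk through v. If all
  smaller instances of both conditions hold, then rotating the walk by one step yields a violation
  of the same size. So the walk is an isometric cycle.\<close>

lemma interval_rotate:
  assumes I: "\<And>j. j < n \<Longrightarrow> interval_condition j" and T: "\<And>j. j < n \<Longrightarrow> triangle_condition j"
    and n: "1 \<le> n" and vx: "d v x = Suc n" and vu: "d v u \<le> n" and vw: "d v w \<le> n"
    and ux: "d u x \<le> 1" and xw: "d x w \<le> 1" and uw: "2 \<le> d u w"
    and vp: "d v p \<le> 1" and pu: "d p u \<le> n - 1"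
  shows "d p w = Suc n"
proof (rule ccontr)
  assume ne: "d p w \<noteq> Suc n"
  have wx: "d w x \<le> 1" using xw d_sym by simp
  have vu': "d v u = n" and vw': "d v w = n"
    using vx vu vw d_tri[of v x u] d_tri[of v x w] ux wx by simp_all
  have pu': "d p u = n - 1" and px: "d p x = n"
    using vp pu vu' vx ux n d_tri[of v u p] d_tri[of p x u] d_tri[of v x p] by linarith+
  have "d p w \<le> Suc n" using vp vw' d_tri[of p w v] d_sym[of p v] by simp
  then have pw: "d p w \<le> n" using ne by simp
  show False
  proof (cases "n = 1")
    case True
    then show False using pu' pw uw d_tri[of u w p] d_sym[of u p] by simp
  next
    case False
    then have "n = Suc (Suc (n - 2))" using n by simp
    then obtain m where m: "n = Suc (Suc m)" by blast
    have In: "interval_condition (Suc m)" and Tn: "triangle_condition (Suc m)"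
      and Tm: "triangle_condition m" and I1: "interval_condition 1"
      using I T m by auto
    show False
    proof (cases "d p w \<le> Suc m")
      case True
      have "d u w \<le> 1"
        by (rule interval_conditionD[OF In, of p x]) (use px pu' m ux wx True in auto)
      with uw show False by simp
    next
      case False
      \<comment> \<open>Here \<open>w\<close> and \<open>x\<close> are equidistant from
        \<open>p\<close>. Common neighbours \<open>y\<close> of \<open>w\<close> and
        \<open>x\<close> towards \<open>p\<close>, \<open>a\<close> of \<open>y\<close> and
        \<open>w\<close> towards \<open>v\<close>, and \<open>b\<close> of \<open>y\<close> and
        \<open>u\<close> towards \<open>p\<close> yield the forbidden pentagon
        \<open>a b u x w\<close>.\<close>
      then have pw': "d p w = Suc (Suc m)" using pw m by simp
      obtain y where y: "d p y = Suc m" "d y w = 1" "d y x = 1"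
        using triangle_conditionD[OF Tn pw' px[unfolded m] wx] by blast
      have yu: "d y u \<le> 1"
        by (rule interval_conditionD[OF In, of p x]) (use px pu' m ux y in auto)
      have vy: "d v y = Suc (Suc m)"
        using d_tri[of v y p] d_tri[of v x y] y vp vx m by simp
      obtain a where a: "d v a = Suc m" "d a y = 1" "d a w = 1"
        using triangle_conditionD[OF Tn vy vw'[unfolded m] eq_imp_le[OF y(2)]] by blast
      have pu'': "d p u = Suc m" using pu' m by simp
      obtain b where b: "d p b = m" "d b y = 1" "d b u = 1"
        using triangle_conditionD[OF Tm y(1) pu'' yu] by blast
      have vb: "d v b \<le> Suc m" using b vp d_tri[of v b p] by simp
      have ab: "d a b \<le> 1"
        by (rule interval_conditionD[OF In vy]) (use a b vb in auto)
      have ax: "d a x = Suc 1" using d_tri[of v x a] d_tri[of a x w] a vx m wx by simp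
      have bx: "d b x = Suc 1" using d_tri[of v x b] d_tri[of b x u] b vb vx m ux by simp
      have au: "2 \<le> d a u"
      proof (rule ccontr)
        assume "\<not> 2 \<le> d a u"
        then have "d u w \<le> 1" using interval_conditionD[OF I1 ax, of u w] ux wx a by simp
        with uw show False by simp
      qed
      have bw: "2 \<le> d b w"
      proof (rule ccontr)
        assume "\<not> 2 \<le> d b w"
        then have "d u w \<le> 1" using interval_conditionD[OF I1 bx, of u w] ux wx b by simp
        with uw show False by simp
      qed
      have "d a b = 1" using ab au b d_tri[of a u b] by simp
      moreover have "d u x = 1" using ux bx b d_tri[of b x u] by simp
      moreover have "d x w = 1" using xw ax a d_tri[of a x w] d_sym[of x w] by simp
      moreover have "d x a = 2" "d w b \<ge> 2" "d w a = 1" using ax bw a d_sym[of x a] d_sym[of w b] d_sym[of w a] by auto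
      ultimately show False using no_pentagon[of a b u x w] b au bx uw by simp
    qed
  qed
qed

text \<open>The base edge \<open>u w\<close> turns to \<open>w q\<close>. If the violation did not
  persist, the available conditions would produce a vertex near \<open>v\<close> adjacent to
  \<open>u\<close> and \<open>w\<close>, or make \<open>u\<close> and \<open>q\<close> adjacent, so
  that \<open>q\<close> would be such a vertex.\<close>

lemma triangle_rotate:
  assumes I: "\<And>j. j \<le> n \<Longrightarrow> interval_condition j" and T: "\<And>j. j < n \<Longrightarrow> triangle_condition j"
    and n: "1 \<le> n" and vu: "d v u = Suc n" and vw: "d v w = Suc n" and uw: "d u w \<le> 1"
    and no: "\<And>t. d v t = n \<Longrightarrow> d t u = 1 \<Longrightarrow> d t w = 1 \<Longrightarrow> False"
    and vp: "d v p \<le> 1" and pu: "d p u \<le> n" and vq: "d v q \<le> n" and qw: "d q w \<le> 1"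
  shows "d p w = Suc n" and "d p q = Suc n"
    and "d p t = n \<Longrightarrow> d t w = 1 \<Longrightarrow> d t q = 1 \<Longrightarrow> False"
proof -
  have no': False if "d v t \<le> n" "d t u \<le> 1" "d t w \<le> 1" for t
    using no[of t] that vu vw d_tri[of v u t] d_tri[of v w t] by linarith
  obtain m where m: "n = Suc m" using n by (metis One_nat_def Suc_le_D)
  have In: "interval_condition n" and Tm: "triangle_condition m" and I1: "interval_condition 1"
    using I T m by auto
  have pu': "d p u = Suc m" using pu vp vu d_tri[of v u p] m by simp
  have wu: "d w u \<le> 1" and pv: "d p v \<le> 1" using uw vp d_sym by simp_all
  have "d p w \<le> Suc n" "d p w \<ge> n"
    using pu uw vp vw d_tri[of p w u] d_tri[of v w p] by simp_all
  moreover have "d p w \<noteq> n"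
  proof
    assume "d p w = n"
    then obtain y where y: "d p y = m" "d y u = 1" "d y w = 1"
      using triangle_conditionD[OF Tm pu' _ uw] m by blast
    with no'[of y] vp d_tri[of v y p] m show False by simp
  qed
  ultimately show pw: "d p w = Suc n" by simp
  have uq: "\<not> d u q \<le> 1" using no'[of q] vq qw d_sym[of u q] by auto
  have "d p q \<le> Suc n" "d p q \<ge> n"
    using pw qw pv vq d_tri[of p w q] d_tri[of p q v] by simp_all
  moreover have "d p q \<noteq> n"
  proof
    assume "d p q = n"
    then have "d u q \<le> 1" using interval_conditionD[OF In pw, of u q] pu uw qw by simp
    with uq show False by simp
  qed
  ultimately show "d p q = Suc n" by simp
  assume t: "d p t = n" "d t w = 1" "d t q = 1"
  have tu: "d t u \<le> 1" using interval_conditionD[OF In pw, of t u] t pu uw by simp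
  have "d v t \<le> Suc n" using t vp d_tri[of v t p] by simp
  with no'[of t] t tu have vt: "d v t = Suc n" by (cases "d v t \<le> n") auto
  have "d u t \<le> 1" using tu d_sym by simp
  then obtain c where c: "d p c = m" "d c u = 1" "d c t = 1"
    using triangle_conditionD[OF Tm pu' t(1)[unfolded m]] by blast
  have "d v c \<le> n" using c vp d_tri[of v c p] m by simp
  then have cq: "d c q \<le> 1" using interval_conditionD[OF In vt, of c q] c vq t d_sym[of q t] by simp
  \<comment> \<open>In the closed walk \<open>c u w q\<close> the vertices \<open>c\<close> and
    \<open>w\<close> are at distance 2, so the interval condition seen from \<open>c\<close> makes
    \<open>u\<close> and \<open>q\<close> adjacent.\<close>
  have "d c w = Suc 1" using c uw pw m d_tri[of p w c] d_tri[of c w u] by simp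
  then have "d u q \<le> 1" using interval_conditionD[OF I1, of c w u q] c cq uw qw by simp
  with uq show False by simp
qed

lemma interval_condition_step:
  assumes I: "\<And>j. j < n \<Longrightarrow> interval_condition j" and T: "\<And>j. j < n \<Longrightarrow> triangle_condition j"
  shows "interval_condition n"
  unfolding interval_condition_def
proof (intro allI impI, rule ccontr)
  fix v x u w
  assume vx: "d v x = Suc n" and vu: "d v u \<le> n" and vw: "d v w \<le> n"
    and xu: "d x u \<le> 1" and xw: "d x w \<le> 1" and "\<not> d u w \<le> 1"
  then have uw: "2 \<le> d u w" by simp
  have n: "1 \<le> n" using uw vu vw d_tri[of u w v] d_sym[of u v] by (cases n) auto
  then obtain m where m: "n = Suc m" by (metis One_nat_def Suc_le_D)
  obtain P where P: "P 0 = v" "P n = u" "\<forall>i\<le>m. d (P i) (P (Suc i)) \<le> 1"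
    using walk_exists[of v u m] vu m by auto
  have "d w v \<le> n" using vw d_sym by simp
  then obtain Q where Q: "Q 0 = w" "Q n = v" "\<forall>i\<le>m. d (Q i) (Q (Suc i)) \<le> 1"
    using walk_exists[of w v m] m by auto
  have ux: "d u x \<le> 1" using xu d_sym by simp
  \<comment> \<open>The walk goes from \<open>v\<close> through \<open>u\<close> to
    \<open>x\<close>, which gets index \<open>Suc n\<close>, then to \<open>w\<close> and back to
    \<open>v\<close>; its length is \<open>2 * n + 2\<close>.\<close>
  obtain c where c: "\<And>i. d (c i) (c (Suc i)) \<le> 1" "\<And>i. c (i + (Suc n + n + 1)) = c i"
    "\<And>i. i \<le> Suc n \<Longrightarrow> c i = (P(Suc n := x)) i" "\<And>i. i \<le> n \<Longrightarrow> c (Suc n + 1 + i) = Q i"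
  proof (rule closed_walk_exists[of "Suc n" "P(Suc n := x)" n Q])
    show "d ((P(Suc n := x)) i) ((P(Suc n := x)) (Suc i)) \<le> 1" if "i < Suc n" for i
      using P ux that m by (cases "i = n") auto
  qed (use P Q xw m in auto)
  have lip: "d (c i) (c j) \<le> j - i" if "i \<le> j" for i j
    using Lipschitz_walk[of c i "j - i"] c(1) that by simp
  have per: "c (i + Suc n + Suc n) = c i" for i
    using c(2)[of i] by (simp add: algebra_simps)
  \<comment> \<open>The violation seen from \<open>c i\<close>: the far vertex is
    \<open>c (i + Suc n)\<close>, whose two neighbours on the walk are not adjacent.\<close>
  have inv: "d (c i) (c (i + Suc n)) = Suc n \<and> 2 \<le> d (c (i + n)) (c (Suc (Suc (i + n))))" for i
  proof (induction i)
    case 0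
    show ?case using c(3)[of 0] c(3)[of n] c(3)[of "Suc n"] c(4)[of 0] P Q vx uw by simp
  next
    case (Suc i)
    have "d (c (Suc i)) (c (Suc (Suc (i + n)))) = Suc n"
    proof (rule interval_rotate[of n "c i" "c (i + Suc n)" "c (i + n)"])
      show "d (c i) (c (Suc (Suc (i + n)))) \<le> n"
        using lip[of "Suc (Suc (i + n))" "i + Suc n + Suc n"] per[of i] d_sym by simp
      show "d (c i) (c (i + n)) \<le> n" "d (c (Suc i)) (c (i + n)) \<le> n - 1"
        using lip[of i "i + n"] lip[of "Suc i" "i + n"] n by simp_all
    qed (use I T n Suc c(1) in auto)
    \<comment> \<open>The rest of the walk, from \<open>c (Suc (Suc (Suc i + n)))\<close> back to
      \<open>c i\<close>, has only \<open>n - 1\<close> steps, so a shortcut here would bring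
      \<open>c (Suc i + n)\<close> within \<open>n\<close> of \<open>c i\<close>.\<close>
    moreover have "2 \<le> d (c (Suc i + n)) (c (Suc (Suc (Suc i + n))))"
      using d_tri[of "c i" "c (Suc i + n)" "c (Suc (Suc (Suc i + n)))"] Suc
        lip[of "Suc (Suc (Suc i + n))" "i + Suc n + Suc n"] per[of i] n
        d_sym[of "c i" "c (Suc (Suc (Suc i + n)))"]
        d_sym[of "c (Suc i + n)" "c (Suc (Suc (Suc i + n)))"] by simp
    ultimately show ?case by simp
  qed
  show False
  proof (rule no_isometric_cycle[of "Suc n + n + 1" c])
    show "3 < Suc n + n + 1" using n by simp
    show "d (c i) (c j) = min (j - i) (Suc n + n + 1 - (j - i))" if "i \<le> j" "j < Suc n + n + 1" for i j
      by (rule isometric_closed_walk[of c "Suc n + n + 1" "Suc n"]) (use c inv that in auto)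
  qed
qed

lemma triangle_condition_step:
  assumes I: "\<And>j. j \<le> n \<Longrightarrow> interval_condition j" and T: "\<And>j. j < n \<Longrightarrow> triangle_condition j"
  shows "triangle_condition n"
  unfolding triangle_condition_def
proof (intro allI impI, rule ccontr)
  fix v u w
  assume vu: "d v u = Suc n" and vw: "d v w = Suc n" and uw: "d u w \<le> 1"
    and no: "\<not> (\<exists>t. d v t = n \<and> d t u = 1 \<and> d t w = 1)"
  have n: "1 \<le> n"
  proof (rule ccontr)
    assume "\<not> 1 \<le> n"
    then show False using no vu vw by (auto dest: spec[of _ v])
  qed
  obtain P where P: "P 0 = v" "P (Suc n) = u" "\<forall>i\<le>n. d (P i) (P (Suc i)) \<le> 1"
    using walk_exists[of v u n] vu by auto
  obtain Q where Q: "Q 0 = w" "Q (Suc n) = v" "\<forall>i\<le>n. d (Q i) (Q (Suc i)) \<le> 1"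
    using walk_exists[of w v n] vw d_sym[of v w] by auto
  obtain c where c: "\<And>i. d (c i) (c (Suc i)) \<le> 1" "\<And>i. c (i + (Suc n + Suc n + 1)) = c i"
    "\<And>i. i \<le> Suc n \<Longrightarrow> c i = P i" "\<And>i. i \<le> Suc n \<Longrightarrow> c (Suc n + 1 + i) = Q i"
    by (rule closed_walk_exists[of "Suc n" P "Suc n" Q]) (use P Q uw in auto)
  have lip: "d (c i) (c j) \<le> j - i" if "i \<le> j" for i j
    using Lipschitz_walk[of c i "j - i"] c(1) that by simp
  \<comment> \<open>The base edge opposite \<open>c i\<close> joins the indices
    \<open>i + n + 1\<close> and \<open>i + n + 2\<close> of a walk of length
    \<open>2 * n + 3\<close>.\<close>
  have inv: "d (c i) (c (i + Suc n)) = Suc n \<and> d (c i) (c (Suc (i + Suc n))) = Suc n \<and>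
     (\<forall>t. d (c i) t = n \<longrightarrow> d t (c (i + Suc n)) = 1 \<longrightarrow> d t (c (Suc (i + Suc n))) = 1 \<longrightarrow> False)" for i
  proof (induction i)
    case 0
    show ?case using c(3)[of 0] c(3)[of "Suc n"] c(4)[of 0] P Q vu vw no by auto
  next
    case (Suc i)
    have "d (c i) (c (Suc (Suc (i + Suc n)))) \<le> n"
      using lip[of "Suc (Suc (i + Suc n))" "i + (Suc n + Suc n + 1)"] c(2)[of i] d_sym by simp
    moreover have "d (c (Suc i)) (c (i + Suc n)) \<le> n"
      using lip[of "Suc i" "i + Suc n"] by simp
    moreover have "d (c (Suc (Suc (i + Suc n)))) (c (Suc (i + Suc n))) \<le> 1"
      using c(1)[of "Suc (i + Suc n)"] d_sym by simp
    ultimately have *: 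
      "d (c (Suc i)) (c (Suc (i + Suc n))) = Suc n" "d (c (Suc i)) (c (Suc (Suc (i + Suc n)))) = Suc n"
      "\<And>t. d (c (Suc i)) t = n \<Longrightarrow> d t (c (Suc (i + Suc n))) = 1
         \<Longrightarrow> d t (c (Suc (Suc (i + Suc n)))) = 1 \<Longrightarrow> False"
      using triangle_rotate[of n "c i" "c (i + Suc n)" "c (Suc (i + Suc n))" "c (Suc i)"
          "c (Suc (Suc (i + Suc n)))"] I T n Suc c(1)[of i] c(1)[of "i + Suc n"] by blast+
    show ?case using * unfolding add_Suc by blast
  qed
  show False
  proof (rule no_isometric_cycle[of "Suc n + Suc n + 1" c])
    show "3 < Suc n + Suc n + 1" using n by simp
    show "d (c i) (c j) = min (j - i) (Suc n + Suc n + 1 - (j - i))"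
      if "i \<le> j" "j < Suc n + Suc n + 1" for i j
      by (rule isometric_closed_walk[of c "Suc n + Suc n + 1" "Suc n"]) (use c inv that in auto)
  qed
qed

lemma interval_triangle: "interval_condition n \<and> triangle_condition n"
proof (induction n rule: less_induct)
  case (less n)
  then have "interval_condition n" by (blast intro: interval_condition_step)
  moreover from this less have "triangle_condition n"
    by (metis le_neq_implies_less triangle_condition_step)
  ultimately show ?case by blast
qed

text \<open>For \<open>d v x = 2\<close> this excludes induced 4-cycles, and it is often used in
  that form.\<close>

lemma interval_adjacent:
  assumes "d v u < d v x" "d v w < d v x" "d u x \<le> 1" "d w x \<le> 1"
  shows "d u w \<le> 1"
proof (cases "d v x")
  case (Suc n)
  then show ?thesis using interval_conditionD[of n v x u w] interval_triangle[of n] assms by auto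
qed (use assms in simp)

lemma common_neighbour:
  assumes "d v u = Suc n" "d v w = Suc n" "d u w \<le> 1"
  obtains t where "d v t = n" "d t u = 1" "d t w = 1"
  using triangle_conditionD[of n v u w] interval_triangle[of n] assms by blast

section \<open>Convexity\<close>

definition convex :: "'a set \<Rightarrow> bool" where
  "convex S \<longleftrightarrow> (\<forall>x\<in>S. \<forall>y\<in>S. \<forall>z. d x z + d z y = d x y \<longrightarrow> z \<in> S)"

definition steps :: "'a set \<Rightarrow> 'a rel" where
  "steps S = {(x, y). x \<in> S \<and> y \<in> S \<and> d x y \<le> 1}"

definition neighbourhood :: "nat \<Rightarrow> 'a set \<Rightarrow> 'a set" where
  "neighbourhood r S = {x. \<exists>s\<in>S. d x s \<le> r}"

lemma convexD: "convex S \<Longrightarrow> x \<in> S \<Longrightarrow> y \<in> S \<Longrightarrow> d x z + d z y = d x y \<Longrightarrow> z \<in> S"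
  unfolding convex_def by blast

lemma convex_twin: "convex S \<Longrightarrow> x \<in> S \<Longrightarrow> d x z = 0 \<Longrightarrow> z \<in> S"
  using convexD[of S x x z] d_sym[of x z] by simp

lemma convex_Inter: "(\<And>S. S \<in> \<S> \<Longrightarrow> convex S) \<Longrightarrow> convex (\<Inter>\<S>)"
  unfolding convex_def by blast

lemma interval_trans:
  assumes "d x y + d y z = d x z" "d x u + d u y = d x y"
  shows "d x u + d u z = d x z"
  using assms d_tri[of u z y] d_tri[of x z u] by simp

text \<open>Let \<open>y'\<close> follow \<open>y\<close> on a geodesic towards \<open>z\<close>.
  The interval condition makes \<open>y'\<close> equal or adjacent to \<open>t\<close>, the triangle
  condition gives \<open>t'\<close> below both, and local convexity between \<open>t'\<close> and
  \<open>y\<close> puts \<open>y'\<close> into \<open>S\<close>; the argument then recurs with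
  \<open>t'\<close> and \<open>y'\<close>, one level closer to \<open>x\<close>.\<close>

lemma convex_extend:
  assumes loc: "\<And>a b z. a \<in> S \<Longrightarrow> b \<in> S \<Longrightarrow> d a b \<le> 2 \<Longrightarrow> d a z + d z b = d a b \<Longrightarrow> z \<in> S"
    and "y \<in> S" "\<And>z. d x z + d z t = d x t \<Longrightarrow> z \<in> S" "d t y = 1" "d x y = Suc (d x t)"
    and "d x z + d z y = d x y"
  shows "z \<in> S"
  using assms(2-)
proof (induction "d x t" arbitrary: t y)
  case (0 t y)
  have "t \<in> S" using 0(3)[of t] by simp
  show ?case
  proof (cases "d z y = 0")
    case True
    then show ?thesis using loc[of y y z] 0(2) d_sym[of z y] by simp
  next
    case False
    then have "d x z = 0" using 0 by simp
    then show ?thesis using 0(1) 0(3)[of z] d_tri[of z t x] d_sym[of z x] by simp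
  qed
next
  case (Suc m t y)
  have tS: "t \<in> S" using Suc.prems(2)[of t] by simp
  show ?case
  proof (cases "d z y")
    case 0
    then show ?thesis using loc[of y y z] Suc.prems d_sym[of z y] by simp
  next
    case (Suc k)
    then have "d y z = Suc k" using d_sym by simp
    from d_step[OF this] obtain y' where y': "d y y' = 1" "d y' z = k" by blast
    have z': "d z y' = k" and y'y: "d y' y = 1" using y' d_sym by simp_all
    have xy': "d x y' = Suc m"
      using Suc z' y' Suc.hyps(2) Suc.prems d_tri[of x y' z] d_tri[of x y y'] d_sym[of y y'] by simp
    have zI: "d x z + d z y' = d x y'" using Suc z' xy' Suc.hyps(2) Suc.prems by simp
    have y't: "d y' t \<le> 1"
      by (rule interval_adjacent[of x _ y]) (use xy' y'y Suc.hyps(2) Suc.prems in auto)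
    show ?thesis
    proof (cases "d y' t = 0")
      case True
      then have "d z t = d z y'" "d x t = d x y'"
        using d_tri[of z t y'] d_tri[of z y' t] d_sym[of y' t] Suc.hyps(2) xy' by simp_all
      then show ?thesis using zI Suc.prems(2)[of z] by simp
    next
      case False
      then have y't1: "d y' t = 1" using y't by simp
      obtain t' where t': "d x t' = m" "d t' y' = 1" "d t' t = 1"
        using common_neighbour[OF xy' Suc.hyps(2)[symmetric] y't] by blast
      have sub: "d x u + d u t = d x t" if "d x u + d u t' = d x t'" for u
        using interval_trans[of x t' t u] that t' Suc.hyps(2) by simp
      have t'S: "t' \<in> S" using Suc.prems(2) sub[of t'] by simp
      have t'y: "d t' y = 2"
        using t' y'y Suc.hyps(2) Suc.prems d_tri[of t' y y'] d_tri[of x y t'] by simp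
      have y'S: "y' \<in> S" by (rule loc[of t' y]) (use t'S t'y t' y'y Suc.prems in auto)
      show ?thesis
        by (rule Suc.hyps(1)[of t' y']) (use t' y'S sub Suc.prems(2) xy' zI in auto)
    qed
  qed
qed

text \<open>Induction along a walk in \<open>S\<close> keeps the interval from \<open>x\<close> to
  the current end inside \<open>S\<close>. When a step moves away from \<open>x\<close>,
  \<open>convex_extend\<close> applies to the old end; when it keeps the distance, to a common
  neighbour closer to \<open>x\<close>.\<close>

lemma convex_local_to_global:
  assumes loc: "\<And>a b z. a \<in> S \<Longrightarrow> b \<in> S \<Longrightarrow> d a b \<le> 2 \<Longrightarrow> d a z + d z b = d a b \<Longrightarrow> z \<in> S"
    and conn: "\<And>x y. x \<in> S \<Longrightarrow> y \<in> S \<Longrightarrow> (x, y) \<in> (steps S)\<^sup>*"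
  shows "convex S"
  unfolding convex_def
proof (intro ballI allI impI)
  fix x y z
  assume xS: "x \<in> S" and "y \<in> S" and z: "d x z + d z y = d x y"
  have twin: "b \<in> S" if "a \<in> S" "d a b = 0" for a b
    using loc[of a a b] that d_sym[of a b] by simp
  from conn[OF xS \<open>y \<in> S\<close>] z show "z \<in> S"
  proof (induction arbitrary: z rule: rtrancl_induct)
    case base
    then show ?case using twin[OF xS] by simp
  next
    case (step y\<^sub>1 y)
    have IH: "u \<in> S" if "d x u + d u y\<^sub>1 = d x y\<^sub>1" for u using step.IH that by blast
    have yS: "y\<^sub>1 \<in> S" "y \<in> S" "d y\<^sub>1 y \<le> 1" using step.hyps(2) by (auto simp: steps_def)
    show ?case
    proof (cases "d y\<^sub>1 y = 0")
      case True
      then have "d x y = d x y\<^sub>1" "d z y = d z y\<^sub>1"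
        using d_tri[of x y y\<^sub>1] d_tri[of x y\<^sub>1 y] d_tri[of z y y\<^sub>1] d_tri[of z y\<^sub>1 y] d_sym[of y y\<^sub>1] by simp_all
      then show ?thesis using IH step.prems by simp
    next
      case False
      then have adj: "d y\<^sub>1 y = 1" using yS by simp
      then have adj': "d y y\<^sub>1 = 1" using d_sym by simp
      consider "d x y\<^sub>1 = Suc (d x y)" | "d x y = d x y\<^sub>1" | "d x y = Suc (d x y\<^sub>1)"
        using adj adj' d_tri[of x y y\<^sub>1] d_tri[of x y\<^sub>1 y] by fastforce
      then show ?thesis
      proof cases
        case 1
        then show ?thesis using IH[of z] interval_trans[of x y y\<^sub>1 z] step.prems adj' by simp
      next
        case 2
        show ?thesis
        proof (cases "d x y")
          case 0
          then show ?thesis using twin[OF xS, of z] step.prems by simp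
        next
          case (Suc m)
          then obtain t where t: "d x t = m" "d t y = 1" "d t y\<^sub>1 = 1"
            using common_neighbour[of x y m y\<^sub>1] 2 adj' by auto
          show ?thesis
          proof (rule convex_extend[OF loc])
            show "u \<in> S" if "d x u + d u t = d x t" for u
              using IH[of u] interval_trans[of x t y\<^sub>1 u] that t 2 Suc by simp
          qed (use t Suc yS step.prems in auto)
        qed
      next
        case 3
        show ?thesis
          by (rule convex_extend[OF loc]) (use 3 adj IH yS step.prems in auto)
      qed
    qed
  qed
qed

section \<open>Convexity of balls and of neighbourhoods of convex sets\<close>

lemma steps_interval:
  assumes "\<And>z. d x z + d z y = d x y \<Longrightarrow> z \<in> S"
  shows "(x, y) \<in> (steps S)\<^sup>*"
  using assms
proof (induction "d x y" arbitrary: x)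
  case 0
  have "x \<in> S" "y \<in> S" using 0(2)[of x] 0(2)[of y] by simp_all
  then show ?case using 0 by (auto simp: steps_def)
next
  case (Suc n)
  obtain z where z: "d x z = 1" "d z y = n" using d_step[of x y n] Suc.hyps(2) by auto
  have "u \<in> S" if "d z u + d u y = d z y" for u
    using Suc.prems[of u] that z Suc.hyps(2) d_tri[of x u z] d_tri[of x y u] by simp
  then have "(z, y) \<in> (steps S)\<^sup>*" using Suc.hyps(1)[of z] z by simp
  moreover have "(x, z) \<in> steps S"
    using Suc.prems[of x] Suc.prems[of z] z Suc.hyps(2) by (auto simp: steps_def)
  ultimately show ?case by (rule converse_rtrancl_into_rtrancl[rotated])
qed

lemma steps_sym: "(x, y) \<in> (steps S)\<^sup>* \<Longrightarrow> (y, x) \<in> (steps S)\<^sup>*"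
proof -
  have "sym (steps S)" using d_sym by (auto simp: steps_def sym_def)
  then show "(x, y) \<in> (steps S)\<^sup>* \<Longrightarrow> (y, x) \<in> (steps S)\<^sup>*" by (meson sym_rtrancl symD)
qed

text \<open>A point outside the ball but between two of its points at distance 2 would be farther
  from \<open>v\<close> than both, which makes these two adjacent.\<close>

lemma convex_ball: "convex {x. d v x \<le> r}"
proof (rule convex_local_to_global)
  fix a b z
  assume a: "a \<in> {x. d v x \<le> r}" and b: "b \<in> {x. d v x \<le> r}" and ab: "d a b \<le> 2"
    and z: "d a z + d z b = d a b"
  consider "d a z = 0" | "d z b = 0" | "d a z = 1" "d z b = 1" "d a b = 2" using ab z by linarith
  then show "z \<in> {x. d v x \<le> r}"
  proof cases
    case 3
    show ?thesis
    proof (rule ccontr)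
      assume "z \<notin> {x. d v x \<le> r}"
      then have "d a b \<le> 1" using interval_adjacent[of v a z b] a b 3 d_sym[of b z] by simp
      with 3 show False by simp
    qed
  qed (use a b d_tri[of v z a] d_tri[of v z b] d_sym[of z b] in auto)
next
  fix x y
  assume "x \<in> {x. d v x \<le> r}" "y \<in> {x. d v x \<le> r}"
  then have "(v, x) \<in> (steps {x. d v x \<le> r})\<^sup>*" "(v, y) \<in> (steps {x. d v x \<le> r})\<^sup>*"
    by (auto intro!: steps_interval)
  then show "(x, y) \<in> (steps {x. d v x \<le> r})\<^sup>*" using steps_sym rtrancl_trans by metis
qed

text \<open>Induction on \<open>d p p'\<close>. At distance 0 the interval condition seen from
  \<open>z\<close> suffices, and at distance 1 the pentagon \<open>a p p' b z\<close> is excluded;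
  otherwise \<open>p\<close> is moved one step along a geodesic of \<open>C\<close>.\<close>

lemma convex_closest_adjacent:
  assumes C: "convex C" and z: "z \<notin> neighbourhood 1 C"
    and "p \<in> C" "p' \<in> C" "d a p = 1" "d b p' = 1" "d a z = 1" "d b z = 1"
  shows "d a b \<le> 1"
  using assms(3-)
proof (induction "d p p'" arbitrary: p a)
  case (0 p a)
  have "d z q > 1" if "q \<in> C" for q using z that by (force simp: neighbourhood_def not_le)
  then have "d z p' > 1" using 0 by simp
  moreover have "d a p' = 1"
    using 0(1) 0(4) d_tri[of a p' p] d_tri[of a p p'] d_sym[of p p'] by simp
  ultimately show ?case
    using interval_adjacent[of z a p' b] 0 d_sym[of z a] d_sym[of z b] by simp
next
  case (Suc l p a)
  have far: "d z q \<ge> 2" if "q \<in> C" for q using z that by (force simp: neighbourhood_def not_less_eq_eq)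
  have two: "d z q = 2" if "q \<in> C" "d e q = 1" "d e z = 1" for q e
    using far[OF that(1)] d_tri[of z q e] d_sym[of z e] that by simp
  have zp: "d z p = 2" and zp': "d z p' = 2" using two Suc.prems by auto
  have edge: "d a b \<le> 1"
    if *: "p \<in> C" "p' \<in> C" "d p p' = 1" "d a p = 1" "d b p' = 1" "d a z = 1" "d b z = 1" for p p' a b
  proof (rule ccontr)
    assume ab: "\<not> d a b \<le> 1"
    have zp: "d z p = 2" and zp': "d z p' = 2" using two * by auto
    have "2 \<le> d a p'"
    proof (rule ccontr)
      assume "\<not> 2 \<le> d a p'"
      then show False using interval_adjacent[of z a p' b] zp' ab * d_sym[of z a] d_sym[of z b] by simp
    qed
    moreover have "2 \<le> d p b"
    proof (rule ccontr)
      assume "\<not> 2 \<le> d p b"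
      then show False
        using interval_adjacent[of z a p b] zp ab * d_sym[of z a] d_sym[of z b] d_sym[of p b] by simp
    qed
    ultimately show False
      using no_pentagon[of a p p' b z] * zp zp' ab
        d_sym[of p' b] d_sym[of z a] d_sym[of b a] d_sym[of p z] d_sym[of p' z] by simp
  qed
  show ?case
  proof (cases l)
    case 0
    then show ?thesis using edge[of p p' a b] Suc by simp
  next
    case (Suc k)
    note l = Suc
    obtain c where c: "d p c = 1" "d c p' = l" using d_step[of p p' l] Suc.hyps(2) by auto
    obtain e where e: "d c e = 1" "d e p' = k" using d_step[of c p' k] c l by auto
    have cC: "c \<in> C" by (rule convexD[OF C, of p p']) (use c Suc.prems \<open>Suc l = d p p'\<close> in auto)
    have eC: "e \<in> C" by (rule convexD[OF C, of c p']) (use cC c e Suc.prems l in auto)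
    have pe: "d p e = 2"
      using c e l \<open>Suc l = d p p'\<close> d_tri[of p e c] d_tri[of p p' e] by simp
    \<comment> \<open>The geodesic from \<open>p\<close> to \<open>p'\<close> stays in the ball of
      radius 2 around \<open>z\<close> by convexity, and outside that of radius 1 since it lies in
      \<open>C\<close>; so \<open>c\<close> and \<open>e\<close> are at distance exactly 2.\<close>
    have "convex {x. d z x \<le> 2}" by (rule convex_ball)
    from convexD[OF this, of p p' c] convexD[OF this, of c p' e]
    have zc: "d z c = Suc 1" and ze: "d z e = Suc 1"
      using zp zp' c e l \<open>Suc l = d p p'\<close> far[OF cC] far[OF eC] by auto
    obtain s where s: "d z s = 1" "d s c = 1" "d s e = 1"
      using common_neighbour[OF zc ze] e by auto
    have sz: "d s z = 1" using s d_sym by simp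
    have as: "d a s \<le> 1" using edge[of p c a s] Suc.prems cC c s sz by simp
    have sC: "s \<notin> C" using far[of s] s by auto
    \<comment> \<open>Otherwise \<open>s\<close> would lie between \<open>p\<close> and
      \<open>e\<close> and hence in \<open>C\<close>, although it is adjacent to
      \<open>z\<close>.\<close>
    have ps: "2 \<le> d p s"
    proof (rule ccontr)
      assume "\<not> 2 \<le> d p s"
      then have "d p s + d s e = d p e" using pe s d_tri[of p e s] by simp
      with sC convexD[OF C _ eC, of p s] Suc.prems show False by simp
    qed
    have "d a c \<le> 1"
      using interval_adjacent[of p a s c] ps Suc.prems c as d_sym[of p a] d_sym[of c s] s by simp
    moreover have "d a c \<noteq> 0" using far[OF cC] d_tri[of z c a] d_sym[of z a] Suc.prems by auto
    ultimately have "d a c = 1" by simp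
    then show ?thesis using Suc.hyps(1)[of c a] c cC Suc.prems by simp
  qed
qed

lemma convex_neighbourhood_1:
  assumes C: "convex C"
  shows "convex (neighbourhood 1 C)"
proof (rule convex_local_to_global)
  have twin: "y \<in> neighbourhood 1 C" if "x \<in> neighbourhood 1 C" "d x y = 0" for x y
  proof -
    obtain s where "s \<in> C" "d x s \<le> 1" using \<open>x \<in> neighbourhood 1 C\<close> by (auto simp: neighbourhood_def)
    moreover have "d y s \<le> d x s" using d_tri[of y s x] d_sym[of y x] that by simp
    ultimately show ?thesis unfolding neighbourhood_def by force
  qed
  fix a b z
  assume a: "a \<in> neighbourhood 1 C" and b: "b \<in> neighbourhood 1 C" and ab: "d a b \<le> 2"
    and z: "d a z + d z b = d a b"
  consider "d a z = 0" | "d z b = 0" | "d a z = 1" "d z b = 1" "d a b = 2" using ab z by linarith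
  then show "z \<in> neighbourhood 1 C"
  proof cases
    case 1
    then show ?thesis using twin a by simp
  next
    case 2
    then show ?thesis using twin[of b z] b d_sym[of z b] by simp
  next
    case 3
    show ?thesis
    proof (rule ccontr)
      assume zN: "z \<notin> neighbourhood 1 C"
      have "\<exists>p\<in>C. d x p = 1" if x: "x \<in> neighbourhood 1 C" "d x z = 1" for x
      proof -
        obtain p where p: "p \<in> C" "d x p \<le> 1" using x by (auto simp: neighbourhood_def)
        have "d x p \<noteq> 0"
        proof
          assume "d x p = 0"
          then have "d z p \<le> 1" using d_tri[of z p x] d_sym[of z x] x by simp
          with p zN show False by (auto simp: neighbourhood_def)
        qed
        with p show ?thesis by (intro bexI[of _ p]) auto
      qed
      from this[OF a] this[OF b] obtain p p' where
        "p \<in> C" "d a p = 1" "p' \<in> C" "d b p' = 1" using 3 d_sym[of z b] by auto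
      then have "d a b \<le> 1"
        using convex_closest_adjacent[OF C zN, of p p' a b] 3 d_sym[of z b] by simp
      with 3 show False by simp
    qed
  qed
next
  fix x y
  assume x: "x \<in> neighbourhood 1 C" and y: "y \<in> neighbourhood 1 C"
  have sub: "C \<subseteq> neighbourhood 1 C" by (force simp: neighbourhood_def)
  obtain p q where pq: "p \<in> C" "q \<in> C" "d x p \<le> 1" "d q y \<le> 1"
    using x y d_sym by (auto simp: neighbourhood_def)
  have "(x, p) \<in> (steps (neighbourhood 1 C))\<^sup>*" "(q, y) \<in> (steps (neighbourhood 1 C))\<^sup>*"
    using pq x y sub by (auto simp: steps_def)
  moreover have "(p, q) \<in> (steps (neighbourhood 1 C))\<^sup>*"
    by (rule steps_interval) (use sub convexD[OF C pq(1,2)] in blast)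
  ultimately show "(x, y) \<in> (steps (neighbourhood 1 C))\<^sup>*" by (meson rtrancl_trans)
qed

lemma neighbourhood_Suc: "neighbourhood (Suc r) C = neighbourhood 1 (neighbourhood r C)"
proof (intro equalityI subsetI)
  fix x
  assume "x \<in> neighbourhood (Suc r) C"
  then obtain s where s: "s \<in> C" "d x s \<le> Suc r" by (auto simp: neighbourhood_def)
  show "x \<in> neighbourhood 1 (neighbourhood r C)"
  proof (cases "d x s")
    case 0
    then have "x \<in> neighbourhood r C" using s by (force simp: neighbourhood_def)
    then show ?thesis by (force simp: neighbourhood_def)
  next
    case (Suc n)
    from d_step[OF this] obtain z where "d x z = 1" "d z s = n" by blast
    then show ?thesis using s Suc unfolding neighbourhood_def by force
  qed
next
  fix x
  assume "x \<in> neighbourhood 1 (neighbourhood r C)"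
  then obtain y s where "d x y \<le> 1" "s \<in> C" "d y s \<le> r" by (auto simp: neighbourhood_def)
  then have "d x s \<le> Suc r" using d_tri[of x s y] by simp
  with \<open>s \<in> C\<close> show "x \<in> neighbourhood (Suc r) C" by (auto simp: neighbourhood_def)
qed

lemma convex_neighbourhood:
  assumes "convex C"
  shows "convex (neighbourhood r C)"
proof (induction r)
  case 0
  have "neighbourhood 0 C = C"
    using convex_twin[OF assms] d_sym by (force simp: neighbourhood_def)
  then show ?case using assms by simp
next
  case (Suc r)
  then show ?case by (subst neighbourhood_Suc) (rule convex_neighbourhood_1)
qed

text \<open>Take z and the least e such that all members of the family meet the ball of radius e around z.
  If e > 0, the convex (e - 1)-neighbourhoods of the small members miss z, so they cut out cliques from
  the neighbours of z. These are finite and directed downwards, so they have a common vertex,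
  which contradicts the choice of e.\<close>

lemma convex_directed_Inter_nonempty:
  assumes conv: "\<And>C. C \<in> \<C> \<Longrightarrow> convex C"
    and dir: "\<And>C D. C \<in> \<C> \<Longrightarrow> D \<in> \<C> \<Longrightarrow> \<exists>B\<in>\<C>. B \<subseteq> C \<inter> D"
    and ne: "\<C> \<noteq> {}"
    and bounded: "\<And>C. C \<in> \<C> \<Longrightarrow> o' \<in> neighbourhood k C"
    and cliques: "\<And>Q. Q \<subseteq> V \<Longrightarrow> (\<And>x y. x \<in> Q \<Longrightarrow> y \<in> Q \<Longrightarrow> d x y \<le> 1) \<Longrightarrow> finite Q"
  shows "\<Inter>\<C> \<noteq> {}"
proof -
  define P where "P = (\<lambda>e. \<exists>z. \<forall>C\<in>\<C>. z \<in> neighbourhood e C)"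
  define e where "e = (LEAST e. P e)"
  have "P k" using bounded P_def by blast
  then have "P e" unfolding e_def by (rule LeastI)
  then obtain z where z: "\<And>C. C \<in> \<C> \<Longrightarrow> z \<in> neighbourhood e C" unfolding P_def by blast
  show ?thesis
  proof (cases e)
    case 0
    have "z \<in> C" if C: "C \<in> \<C>" for C
    proof -
      obtain s where "s \<in> C" "d z s = 0" using z[OF C] 0 by (auto simp: neighbourhood_def)
      then show ?thesis using convex_twin[OF conv[OF C], of s z] d_sym[of s z] by simp
    qed
    then show ?thesis by blast
  next
    case (Suc r)
    have minimal: "\<exists>C\<in>\<C>. z' \<notin> neighbourhood r C" for z'
      using not_less_Least[of r P] Suc e_def unfolding P_def by auto
    then obtain C\<^sub>0 where C0: "C\<^sub>0 \<in> \<C>" "z \<notin> neighbourhood r C\<^sub>0" by blast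
    define Q where "Q = (\<lambda>C. {q \<in> V. d q z \<le> 1 \<and> q \<in> neighbourhood r C})"
    have mono: "Q B \<subseteq> Q C" if "B \<subseteq> C" for B C
      using that unfolding Q_def neighbourhood_def by blast
    have fin: "finite (Q C)" if "C \<in> \<C>" "C \<subseteq> C\<^sub>0" for C
    proof (rule cliques)
      fix x y
      assume "x \<in> Q C" "y \<in> Q C"
      then have xy: "d x z \<le> 1" "d z y \<le> 1" "x \<in> neighbourhood r C" "y \<in> neighbourhood r C"
        using d_sym by (auto simp: Q_def)
      have zC: "z \<notin> neighbourhood r C" using C0 that by (auto simp: neighbourhood_def)
      show "d x y \<le> 1"
      proof (rule ccontr)
        assume "\<not> d x y \<le> 1"
        then have "d x z + d z y = d x y" using xy d_tri[of x y z] by simp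
        with zC convexD[OF convex_neighbourhood[OF conv[OF that(1)]] xy(3,4)] show False by blast
      qed
    qed (auto simp: Q_def)
    have nonempty: "Q C \<noteq> {}" if C: "C \<in> \<C>" "C \<subseteq> C\<^sub>0" for C
    proof -
      have "z \<notin> neighbourhood r C" using C0 C by (auto simp: neighbourhood_def)
      moreover obtain s where s: "s \<in> C" "d z s \<le> Suc r"
        using z[OF C(1)] Suc by (auto simp: neighbourhood_def)
      ultimately have "d z s = Suc r" using le_Suc_eq by (auto simp: neighbourhood_def)
      from d_step[OF this] obtain q where "q \<in> V" "d z q = 1" "d q s = r" by blast
      then have "q \<in> Q C" using s d_sym[of q z] by (auto simp: Q_def neighbourhood_def)
      then show ?thesis by blast
    qed
    obtain C where C: "C \<in> \<C>" "C \<subseteq> C\<^sub>0"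
      and least: "\<And>B. B \<in> \<C> \<Longrightarrow> B \<subseteq> C\<^sub>0 \<Longrightarrow> card (Q C) \<le> card (Q B)"
      using ex_has_least_nat[of "\<lambda>C. C \<in> \<C> \<and> C \<subseteq> C\<^sub>0" C\<^sub>0 "\<lambda>C. card (Q C)"] C0 by blast
    obtain q where q: "q \<in> Q C" using nonempty[OF C] by blast
    \<comment> \<open>A clique \<open>Q C\<close> of least cardinality cannot shrink when
      \<open>C\<close> is replaced by a smaller member, in particular by one inside
      \<open>D\<close>.\<close>
    have "q \<in> neighbourhood r D" if D: "D \<in> \<C>" for D
    proof -
      obtain B where B: "B \<in> \<C>" "B \<subseteq> C \<inter> D" using dir[OF C(1) D] by blast
      have "card (Q C) \<le> card (Q B)" using least[OF B(1)] B C by blast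
      then have "Q B = Q C" using card_seteq[OF fin[OF C] mono[of B C]] B by blast
      with q have "q \<in> Q D" using mono[of B D] B by blast
      then show ?thesis by (simp add: Q_def)
    qed
    with minimal show ?thesis by blast
  qed
qed

section \<open>Antipodes\<close>

text \<open>No distance exceeds m + 3, so \<open>y\<close> and \<open>p\<close> cannot be farther
  from \<open>v\<close> than \<open>x\<^sub>1\<close>. They cannot be closer either: the interval
  condition would then create a shortcut from \<open>w\<close> to \<open>x\<^sub>2\<close> or
  \<open>x\<^sub>3\<close>. Hence both are antipodes of \<open>v\<close>, and \<open>z\<close> is
  their common neighbour towards \<open>v\<close>.\<close>

lemma antipode_turn:
  assumes bound: "\<And>x y. d x y \<le> Suc (Suc (Suc m))"
    and x: "d x\<^sub>1 x\<^sub>2 = 1" "d x\<^sub>2 x\<^sub>3 = 1" "d x\<^sub>1 x\<^sub>3 = 1"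
    and v: "d v x\<^sub>1 = Suc (Suc (Suc m))" "d v x\<^sub>2 \<le> Suc (Suc m)" "d v x\<^sub>3 \<le> Suc (Suc m)"
    and w: "d w x\<^sub>2 = Suc (Suc (Suc m))"
    and y: "d y x\<^sub>1 = 1" "d y x\<^sub>3 = 1" "d w y = Suc m"
    and p: "d y p = 1" "d w p = m"
  shows "\<exists>z. d z y = 1 \<and> d z p = 1 \<and> d z x\<^sub>3 = 1 \<and> 2 \<le> d z x\<^sub>1"
proof -
  have sym: "d x\<^sub>2 x\<^sub>1 = 1" "d x\<^sub>3 x\<^sub>2 = 1" "d x\<^sub>3 x\<^sub>1 = 1" "d p y = 1" "d x\<^sub>3 y = 1"
    using x y p d_sym by simp_all
  have wx3: "Suc (Suc m) \<le> d w x\<^sub>3" using w x sym d_tri[of w x\<^sub>2 x\<^sub>3] by simp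
  have vy: "d v y = Suc (Suc (Suc m))"
  proof (rule ccontr)
    assume "d v y \<noteq> Suc (Suc (Suc m))"
    then have "d v y < Suc (Suc (Suc m))" using bound[of v y] by simp
    then have "d y x\<^sub>2 \<le> 1" using interval_adjacent[of v y x\<^sub>1 x\<^sub>2] v y sym by simp
    then show False using d_tri[of w x\<^sub>2 y] w y by simp
  qed
  have px3: "2 \<le> d p x\<^sub>3" using wx3 p d_tri[of w x\<^sub>3 p] by simp
  have vp: "d v p = Suc (Suc (Suc m))"
  proof (rule ccontr)
    assume "d v p \<noteq> Suc (Suc (Suc m))"
    then have "d v p < Suc (Suc (Suc m))" using bound[of v p] by simp
    then have "d p x\<^sub>3 \<le> 1" using interval_adjacent[of v p y x\<^sub>3] v vy sym by simp
    with px3 show False by simp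
  qed
  obtain z where z: "d v z = Suc (Suc m)" "d z y = 1" "d z p = 1"
    using common_neighbour[OF vy vp] p by auto
  have "d z x\<^sub>3 \<le> 1" using interval_adjacent[of v z y x\<^sub>3] z v vy sym by simp
  moreover have "d z x\<^sub>3 \<noteq> 0" using px3 d_tri[of p x\<^sub>3 z] d_sym[of p z] z by auto
  moreover have "2 \<le> d z x\<^sub>1"
  proof (rule ccontr)
    assume "\<not> 2 \<le> d z x\<^sub>1"
    then have "d z x\<^sub>2 \<le> 1" using interval_adjacent[of v z x\<^sub>1 x\<^sub>2] v z sym by simp
    then show False using d_tri[of w x\<^sub>2 z] d_tri[of w z p] w p z d_sym[of p z] by simp
  qed
  ultimately show ?thesis using z by (intro exI[of _ z]) auto
qed

text \<open>The picture is that of three 60-degree sectors in the triangulated plane, emanating from the edges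
  of a triangle: far out in these sectors, two of any three points are further apart than the points
  are from the triangle. Here a short distance to both other sectors produces an induced pentagon
  or quadrangle among the neighbours of y.\<close>

lemma no_antipodal_triangle:
  assumes k: "3 \<le> k" and bound: "\<And>x y. d x y \<le> k"
    and x: "d x\<^sub>1 x\<^sub>2 = 1" "d x\<^sub>2 x\<^sub>3 = 1" "d x\<^sub>1 x\<^sub>3 = 1"
    and v1: "d v\<^sub>1 x\<^sub>1 = k" "d v\<^sub>1 x\<^sub>2 < k" "d v\<^sub>1 x\<^sub>3 < k"
    and v2: "d v\<^sub>2 x\<^sub>2 = k" "d v\<^sub>2 x\<^sub>1 < k" "d v\<^sub>2 x\<^sub>3 < k"
    and v3: "d v\<^sub>3 x\<^sub>3 = k" "d v\<^sub>3 x\<^sub>1 < k" "d v\<^sub>3 x\<^sub>2 < k"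
  shows False
proof -
  have "k = Suc (Suc (Suc (k - 3)))" using k by simp
  \<comment> \<open>There is room for \<open>y\<close> at distance m + 1 and \<open>p\<close> at
    distance \<open>m\<close> from \<open>v\<^sub>2\<close>.\<close>
  then obtain m where m: "k = Suc (Suc (Suc m))" by blast
  have sym: "d x\<^sub>2 x\<^sub>1 = 1" "d x\<^sub>3 x\<^sub>2 = 1" "d x\<^sub>3 x\<^sub>1 = 1" using x d_sym by simp_all
  have v2x: "d v\<^sub>2 x\<^sub>1 = Suc (Suc m)" "d v\<^sub>2 x\<^sub>3 = Suc (Suc m)"
    using v2 m x sym d_tri[of v\<^sub>2 x\<^sub>2 x\<^sub>1] d_tri[of v\<^sub>2 x\<^sub>2 x\<^sub>3] by simp_all
  obtain y where y: "d v\<^sub>2 y = Suc m" "d y x\<^sub>1 = 1" "d y x\<^sub>3 = 1"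
    using common_neighbour[OF v2x] x by auto
  have "d y v\<^sub>2 = Suc m" using y d_sym by simp
  from d_step[OF this] obtain p where p: "d y p = 1" "d v\<^sub>2 p = m" using d_sym by metis
  obtain z where z: "d z y = 1" "d z p = 1" "d z x\<^sub>3 = 1" "2 \<le> d z x\<^sub>1"
    using antipode_turn[of m x\<^sub>1 x\<^sub>2 x\<^sub>3 v\<^sub>1 v\<^sub>2 y p] bound v1 v2 x y p m by auto
  \<comment> \<open>The mirror image, with the indices 1 and 3 exchanged.\<close>
  obtain z' where z': "d z' y = 1" "d z' p = 1" "d z' x\<^sub>1 = 1" "2 \<le> d z' x\<^sub>3"
    using antipode_turn[of m x\<^sub>3 x\<^sub>2 x\<^sub>1 v\<^sub>3 v\<^sub>2 y p] bound v3 v2 sym y p m by auto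
  have px: "2 \<le> d p x\<^sub>1" "2 \<le> d p x\<^sub>3"
    using v2x p d_tri[of v\<^sub>2 x\<^sub>1 p] d_tri[of v\<^sub>2 x\<^sub>3 p] by simp_all
  \<comment> \<open>If \<open>z\<close> and \<open>z'\<close> are within distance 1, the interval
    condition seen from \<open>x\<^sub>1\<close> makes \<open>x\<^sub>3\<close> and
    \<open>z'\<close> adjacent; otherwise \<open>x\<^sub>3 x\<^sub>1 z' p z\<close> is an induced
    pentagon.\<close>
  show False
  proof (cases "d z z' \<le> 1")
    case True
    then have "d x\<^sub>3 z' \<le> 1"
      using interval_adjacent[of x\<^sub>1 x\<^sub>3 z z'] z z' x d_sym[of x\<^sub>3 z] d_sym[of z z'] d_sym[of x\<^sub>1 z]
        d_sym[of x\<^sub>1 z'] by simp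
    with z' show False using d_sym[of x\<^sub>3 z'] by simp
  next
    case False
    then show False
      using no_pentagon[of x\<^sub>3 x\<^sub>1 z' p z] z z' px sym
        d_sym[of x\<^sub>1 z'] d_sym[of p z] d_sym[of x\<^sub>3 z'] d_sym[of x\<^sub>1 p] d_sym[of z' z] by simp
  qed
qed

text \<open>The point \<open>w\<close> is equidistant from \<open>x\<close> and \<open>y\<close>:
  otherwise one of them would lie on a geodesic from \<open>w\<close> to the other, in the convex
  set that avoids it. The common neighbour towards \<open>w\<close> then lies on geodesics inside
  \<open>A\<close> and inside \<open>B\<close>.\<close>

lemma convex_edge_neighbour:
  assumes xy: "d x y = 1" and A: "convex A" "x \<notin> A" "y \<in> A" and B: "convex B" "x \<in> B" "y \<notin> B"
    and w: "w \<in> A" "w \<in> B"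
  obtains z where "d z x = 1" "d z y = 1" "z \<in> A" "z \<in> B"
proof -
  have yx: "d y x = 1" using xy d_sym by simp
  have "d w x \<le> d w y"
  proof (rule ccontr)
    assume "\<not> d w x \<le> d w y"
    then have "d w y + d y x = d w x" using d_tri[of w x y] yx by simp
    with convexD[OF B(1) w(2) B(2)] B show False by blast
  qed
  moreover have "d w y \<le> d w x"
  proof (rule ccontr)
    assume "\<not> d w y \<le> d w x"
    then have "d w x + d x y = d w y" using d_tri[of w y x] xy by simp
    with convexD[OF A(1) w(1) A(3)] A show False by blast
  qed
  ultimately have eq: "d w x = d w y" by simp
  have "d w x \<noteq> 0" using convex_twin[OF A(1) w(1)] A by blast
  then obtain n where n: "d w x = Suc n" using not0_implies_Suc by blast
  then obtain z where z: "d w z = n" "d z x = 1" "d z y = 1"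
    using common_neighbour[of w x n y] eq xy by auto
  have "z \<in> A" by (rule convexD[OF A(1) w(1) A(3)]) (use z n eq in simp)
  moreover have "z \<in> B" by (rule convexD[OF B(1) w(2) B(2)]) (use z n in simp)
  ultimately show thesis using that z by blast
qed

text \<open>If D x, the set of antipodes of x in F, is never empty, choose x with D x minimal, and then a
  neighbour y of x that avoids an antipode v of x, with the union of D x and D y minimal. For u in D y
  outside D x, there is a common neighbour z of x and y that avoids u and v. By minimality, z has an
  antipode t of its own, and x, y, z with v, u, t are an antipodal triangle.\<close>

lemma finite_antipodes_center:
  assumes k: "3 \<le> k" and bound: "\<And>x y. d x y \<le> k" and F: "finite F"
  shows "\<exists>x. \<forall>v\<in>F. d v x < k"
proof (rule ccontr)
  assume no: "\<not> (\<exists>x. \<forall>v\<in>F. d v x < k)"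
  define D where "D = (\<lambda>x. {v \<in> F. d v x = k})"
  have fin: "finite (D x)" for x using F by (simp add: D_def)
  have ne: "D x \<noteq> {}" for x using no bound by (force simp: D_def order.strict_iff_order)
  obtain x where x: "\<And>y. card (D x) \<le> card (D y)"
    using ex_has_least_nat[of "\<lambda>_. True" undefined "\<lambda>x. card (D x)"] by auto
  obtain v where v: "v \<in> F" "d v x = k" using ne[of x] by (auto simp: D_def)
  have "d x v = Suc (k - 1)" using v k d_sym[of x v] by simp
  from d_step[OF this] obtain y\<^sub>0 where y0: "d x y\<^sub>0 = 1" "d y\<^sub>0 v = k - 1" by blast
  obtain y where y: "d x y = 1" "d v y < k"
    and least: "\<And>z. d x z = 1 \<Longrightarrow> d v z < k \<Longrightarrow> card (D x \<union> D y) \<le> card (D x \<union> D z)"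
    using ex_has_least_nat[of "\<lambda>y. d x y = 1 \<and> d v y < k" y\<^sub>0 "\<lambda>y. card (D x \<union> D y)"]
      y0 k d_sym[of y\<^sub>0 v] by auto
  have "\<not> D y \<subseteq> D x"
  proof
    assume "D y \<subseteq> D x"
    then have "D y = D x" using card_seteq[OF fin] x by blast
    moreover have "v \<in> D x" "v \<notin> D y" using v y by (simp_all add: D_def)
    ultimately show False by simp
  qed
  then obtain u where "u \<in> F" "d u y = k" "d u x \<noteq> k" by (auto simp: D_def)
  then have u: "u \<in> F" "d u y = k" "d u x < k" using bound[of u x] by simp_all
  define ball where "ball v = {x. d v x \<le> k - 1}" for v
  have ball: "convex (ball v)" "z \<in> ball v \<longleftrightarrow> d v z < k" for v z
    using convex_ball k by (auto simp: ball_def)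
  \<comment> \<open>The balls of radius k - 1 around \<open>v\<close> and \<open>u\<close> meet in a
    neighbour of \<open>v\<close> towards \<open>u\<close>, since \<open>d v u \<le> k\<close> and 1
    < k.\<close>
  obtain w where w: "d v w < k" "d u w < k"
  proof (cases "d v u")
    case 0
    then show ?thesis using that[of v] k d_sym[of u v] by simp
  next
    case (Suc n)
    from d_step[OF this] obtain w where "d v w = 1" "d w u = n" by blast
    then show ?thesis using that[of w] k Suc bound[of v u] d_sym[of w u] by simp
  qed
  obtain z where z: "d z x = 1" "d z y = 1" "d v z < k" "d u z < k"
    using convex_edge_neighbour[OF y(1) ball(1)[of v] _ _ ball(1)[of u], of w] w u v y
    by (auto simp: ball(2))
  have "\<not> D z \<subseteq> D x \<union> D y"
  proof
    assume "D z \<subseteq> D x \<union> D y"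
    then have "D x \<union> D z \<subseteq> D x \<union> D y" by blast
    \<comment> \<open>The antipode \<open>u\<close> is lost when \<open>y\<close> is replaced by
      \<open>z\<close>, so the union becomes strictly smaller.\<close>
    moreover have "u \<in> D x \<union> D y" "u \<notin> D x \<union> D z" using u z by (auto simp: D_def)
    ultimately have "D x \<union> D z \<subset> D x \<union> D y" by blast
    then have "card (D x \<union> D z) < card (D x \<union> D y)" by (intro psubset_card_mono) (simp_all add: fin)
    with least[of z] z d_sym[of x z] show False by simp
  qed
  then obtain t where "t \<in> F" "d t z = k" "d t x \<noteq> k" "d t y \<noteq> k" by (auto simp: D_def)
  then have t: "d t z = k" "d t x < k" "d t y < k"
    using bound[of t x] bound[of t y] by simp_all
  show False
    by (rule no_antipodal_triangle[OF k bound, of x y z v u t])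
      (use t u v y z d_sym[of y z] d_sym[of x z] in auto)
qed

text \<open>Intersections of finitely many balls of radius k - 1 form a directed family of convex
  sets, nonempty by the finite case; a point common to all of them lies in every single
  ball.\<close>

lemma antipodes_center:
  assumes k: "3 \<le> k" and bound: "\<And>x y. d x y \<le> k"
    and cliques: "\<And>Q. Q \<subseteq> V \<Longrightarrow> (\<And>x y. x \<in> Q \<Longrightarrow> y \<in> Q \<Longrightarrow> d x y \<le> 1) \<Longrightarrow> finite Q"
  shows "\<exists>x. \<forall>v. d v x < k"
proof -
  define I where "I F = (\<Inter>v\<in>F. {x. d v x \<le> k - 1})" for F
  define \<C> where "\<C> = I ` {F. finite F}"
  have "\<Inter>\<C> \<noteq> {}"
  proof (rule convex_directed_Inter_nonempty)
    show "convex C" if "C \<in> \<C>" for C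
      using that convex_ball by (auto simp: \<C>_def I_def intro!: convex_Inter)
    show "\<exists>B\<in>\<C>. B \<subseteq> C \<inter> D" if "C \<in> \<C>" "D \<in> \<C>" for C D
    proof -
      obtain F G where "finite F" "finite G" "C = I F" "D = I G" using \<open>C \<in> \<C>\<close> \<open>D \<in> \<C>\<close> by (auto simp: \<C>_def)
      then show ?thesis by (intro bexI[of _ "I (F \<union> G)"]) (auto simp: \<C>_def I_def)
    qed
    show "\<C> \<noteq> {}" by (auto simp: \<C>_def)
    \<comment> \<open>Any base point will do, as \<open>C\<close> is nonempty and no distance
      exceeds \<open>k\<close>.\<close>
    show "undefined \<in> neighbourhood k C" if C: "C \<in> \<C>" for C
    proof -
      obtain F where F: "finite F" "C = I F" using C by (auto simp: \<C>_def)
      obtain x where "\<forall>v\<in>F. d v x < k" using finite_antipodes_center[OF k bound F(1)] by blast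
      then have "x \<in> C" using F by (force simp: I_def)
      then show ?thesis using bound by (auto simp: neighbourhood_def)
    qed
  qed (rule cliques)
  then obtain x where x: "\<And>F. finite F \<Longrightarrow> x \<in> I F" by (auto simp: \<C>_def)
  have "d v x < k" for v using x[of "{v}"] k by (simp add: I_def)
  then show ?thesis by blast
qed

end

section \<open>The path metric of a bridged graph\<close>

lemma walk_relpow:
  assumes "\<And>i. (c i, c (Suc i)) \<in> F"
  shows "(c i, c (i + l)) \<in> F ^^ l"
  by (induction l) (use assms in auto)

lemma graph_dist_le: "(u, v) \<in> E ^^ n \<Longrightarrow> graph_dist E u v \<le> enat n"
  unfolding graph_dist_def by (rule INF_lower) simp

lemma graph_dist_enat:
  assumes "(u, v) \<in> E\<^sup>*"
  shows "graph_dist E u v = enat (LEAST n. (u, v) \<in> E ^^ n)"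
proof (rule antisym)
  obtain m where "(u, v) \<in> E ^^ m" using assms rtrancl_imp_relpow by blast
  then show "graph_dist E u v \<le> enat (LEAST n. (u, v) \<in> E ^^ n)" by (intro graph_dist_le LeastI)
  show "enat (LEAST n. (u, v) \<in> E ^^ n) \<le> graph_dist E u v"
    unfolding graph_dist_def by (rule INF_greatest) (simp add: Least_le)
qed

lemma relpow_subset: "(F :: 'a rel) \<subseteq> E \<Longrightarrow> F ^^ n \<subseteq> E ^^ n"
  by (induction n) (simp_all add: relcomp_mono)

lemma graph_dist_mono: "F \<subseteq> E \<Longrightarrow> graph_dist E u v \<le> graph_dist F u v"
  unfolding graph_dist_def using relpow_subset[of F E] by (intro INF_superset_mono) auto

lemma sym_relpow: "sym E \<Longrightarrow> (u, v) \<in> E ^^ n \<Longrightarrow> (v, u) \<in> E ^^ n"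
proof (induction n arbitrary: v)
  case (Suc n)
  then obtain w where "(u, w) \<in> E ^^ n" "(w, v) \<in> E" by auto
  with Suc show ?case by (meson relpow_Suc_I2 symD)
qed simp

text \<open>Points outside V are identified with a vertex, so that distances are total; the price is that
  distinct points may have distance 0.\<close>

definition retract :: "'a set \<Rightarrow> 'a \<Rightarrow> 'a" where
  "retract V x = (if x \<in> V then x else SOME v. v \<in> V)"

definition total_dist :: "'a set \<Rightarrow> 'a rel \<Rightarrow> 'a \<Rightarrow> 'a \<Rightarrow> nat" where
  "total_dist V E x y = (LEAST n. (retract V x, retract V y) \<in> E ^^ n)"

context
  fixes V :: "'a set" and E
  assumes conn: "connected_graph V E"
begin

lemma retract_in: "retract V x \<in> V"
  using conn by (auto simp: retract_def connected_graph_def some_in_eq)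

lemma total_dist_relpow: "(retract V x, retract V y) \<in> E ^^ total_dist V E x y"
proof -
  have "(retract V x, retract V y) \<in> E\<^sup>*" using conn retract_in by (auto simp: connected_graph_def)
  then obtain n where "(retract V x, retract V y) \<in> E ^^ n" using rtrancl_imp_relpow by blast
  then show ?thesis unfolding total_dist_def by (rule LeastI)
qed

lemma total_dist_le: "(retract V x, retract V y) \<in> E ^^ n \<Longrightarrow> total_dist V E x y \<le> n"
  unfolding total_dist_def by (rule Least_le)

lemma graph_dist_total_dist: "u \<in> V \<Longrightarrow> v \<in> V \<Longrightarrow> graph_dist E u v = enat (total_dist V E u v)"
  using conn by (simp add: graph_dist_enat connected_graph_def total_dist_def retract_def)

lemma total_dist_retract: "total_dist V E (retract V x) (retract V y) = total_dist V E x y"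
proof -
  have "retract V (retract V z) = retract V z" for z using retract_in[of z] by (simp only: retract_def if_True)
  then show ?thesis by (simp only: total_dist_def)
qed

lemma graph_metric_total_dist: "graph_metric V (total_dist V E)"
proof
  fix x y z n
  show "total_dist V E x x = 0" using total_dist_le[of x x 0] by simp
  have "total_dist V E x y \<le> total_dist V E y x" for x y
    using total_dist_le sym_relpow total_dist_relpow conn unfolding connected_graph_def by metis
  then show "total_dist V E x y = total_dist V E y x" by (simp add: antisym)
  show "total_dist V E x z \<le> total_dist V E x y + total_dist V E y z"
    by (intro total_dist_le) (use total_dist_relpow[of x y] total_dist_relpow[of y z] in
        \<open>auto simp: relpow_add\<close>)
  assume n: "total_dist V E x y = Suc n"
  then obtain z where z: "(retract V x, z) \<in> E" "(z, retract V y) \<in> E ^^ n"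
    using total_dist_relpow[of x y] relpow_Suc_D2 by metis
  have zV: "z \<in> V" using z conn by (auto simp: connected_graph_def)
  then have rz: "retract V z = z" by (simp add: retract_def)
  have 1: "total_dist V E x z \<le> 1" using total_dist_le[of x z 1] z rz by simp
  have 2: "total_dist V E z y \<le> n" using total_dist_le[of z y n] z rz by simp
  have 3: "total_dist V E x y \<le> total_dist V E x z + total_dist V E z y"
    by (intro total_dist_le) (use total_dist_relpow[of x z] total_dist_relpow[of z y] in
        \<open>auto simp: relpow_add\<close>)
  show "\<exists>z\<in>V. total_dist V E x z = 1 \<and> total_dist V E z y = n"
    by (intro bexI[OF _ zV] conjI) (use 1 2 3 n in linarith)+
qed

lemma total_dist_eq_0: "u \<in> V \<Longrightarrow> v \<in> V \<Longrightarrow> total_dist V E u v = 0 \<longleftrightarrow> u = v"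
  using total_dist_relpow[of u v] graph_metric.d_refl[OF graph_metric_total_dist, of u]
  by (cases "total_dist V E u v = 0") (auto simp: retract_def)

lemma total_dist_eq_1:
  assumes "u \<in> V" "v \<in> V"
  shows "total_dist V E u v = 1 \<longleftrightarrow> (u, v) \<in> E"
proof
  assume "total_dist V E u v = 1"
  then show "(u, v) \<in> E" using total_dist_relpow[of u v] assms by (simp add: retract_def)
next
  assume uv: "(u, v) \<in> E"
  then have "u \<noteq> v" using conn by (auto simp: connected_graph_def irrefl_def)
  then have "total_dist V E u v \<noteq> 0" using total_dist_eq_0 assms by simp
  moreover have "total_dist V E u v \<le> 1" using uv assms by (intro total_dist_le) (simp add: retract_def)
  ultimately show "total_dist V E u v = 1" by simp
qed

end

lemma bridged_metric_total_dist:
  assumes bridged: "bridged_graph V E"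
  shows "bridged_metric V (total_dist V E)"
proof -
  have conn: "connected_graph V E" using bridged by (simp add: bridged_graph_def)
  interpret graph_metric V "total_dist V E" by (rule graph_metric_total_dist[OF conn])
  show ?thesis
  proof
    fix n and c\<^sub>0 :: "nat \<Rightarrow> 'a"
    assume n: "3 < n"
      and "\<And>i j. i \<le> j \<Longrightarrow> j < n \<Longrightarrow> total_dist V E (c\<^sub>0 i) (c\<^sub>0 j) = min (j - i) (n - (j - i))"
    \<comment> \<open>Retraction moves the sequence into \<open>V\<close> without changing
      distances; reduction modulo \<open>n\<close> makes it periodic, so that walks can wrap
      around.\<close>
    define c where "c i = retract V (c\<^sub>0 (i mod n))" for i
    have cV: "c i \<in> V" for i by (simp add: c_def retract_in[OF conn])
    have dist: "total_dist V E (c i) (c j) = min (j - i) (n - (j - i))" if "i \<le> j" "j < n" for i j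
      using \<open>\<And>i j. i \<le> j \<Longrightarrow> j < n \<Longrightarrow> total_dist V E (c\<^sub>0 i) (c\<^sub>0 j) = min (j - i) (n - (j - i))\<close> that
      by (simp add: c_def total_dist_retract[OF conn])
    define W where "W = c ` {..<n}"
    have edge: "(c i, c j) \<in> E \<longleftrightarrow> j = (i + 1) mod n \<or> i = (j + 1) mod n" if "i < n" "j < n" for i j
    proof -
      have *: "(c i, c j) \<in> E \<longleftrightarrow> j = (i + 1) mod n \<or> i = (j + 1) mod n" if "i \<le> j" "j < n" for i j
      proof -
        have "(c i, c j) \<in> E \<longleftrightarrow> min (j - i) (n - (j - i)) = 1"
          using total_dist_eq_1[OF conn cV cV, of i j] dist[OF that] by simp
        also have "\<dots> \<longleftrightarrow> j = Suc i \<or> (i = 0 \<and> Suc j = n)" using that n by (auto simp: min_def)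
        also have "\<dots> \<longleftrightarrow> j = (i + 1) mod n \<or> i = (j + 1) mod n" using that n by (auto simp: mod_Suc)
        finally show ?thesis .
      qed
      have "(c i, c j) \<in> E \<longleftrightarrow> (c j, c i) \<in> E"
        using conn by (auto simp: connected_graph_def sym_def)
      then show ?thesis using *[of i j] *[of j i] that by (cases "i \<le> j") auto
    qed
    have inj: "inj_on c {..<n}"
    proof (rule linorder_inj_onI)
      fix i j
      assume "i < j" "i \<in> {..<n}" "j \<in> {..<n}"
      then have "total_dist V E (c i) (c j) \<noteq> 0" using dist[of i j] by simp
      then show "c i \<noteq> c j" by auto
    qed auto
    have F: "induced_edges E W = {(c i, c j) | i j. i < n \<and> j < n \<and> (j = (i + 1) mod n \<or> i = (j + 1) mod n)}"
      using edge unfolding induced_edges_def W_def by auto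
    have "is_cycle W (induced_edges E W) n"
      unfolding is_cycle_def using n inj F by (auto simp: W_def bij_betw_def intro!: exI[of _ c])
    moreover have "isometric_subgraph V E W"
      unfolding isometric_subgraph_def
    proof (intro conjI ballI)
      show "W \<subseteq> V" using cV by (auto simp: W_def)
      have per: "c (i + n) = c i" for i by (simp add: c_def)
      have WcI: "c i \<in> W" for i
      proof -
        have "c i = c (i mod n)" by (simp add: c_def)
        then show ?thesis using n by (auto simp: W_def)
      qed
      have "(c i, c (Suc i)) \<in> E" for i
      proof -
        have "(c (i mod n), c (Suc i mod n)) \<in> E"
          using edge[of "i mod n" "Suc i mod n"] n by (simp add: mod_Suc_eq)
        then show ?thesis by (simp add: c_def)
      qed
      then have step: "(c i, c (Suc i)) \<in> induced_edges E W" for i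
        using WcI by (auto simp: induced_edges_def)
      have symF: "sym (induced_edges E W)"
        using conn by (auto simp: connected_graph_def induced_edges_def sym_def)
      \<comment> \<open>Both arcs of the cycle run inside \<open>W\<close>, so the shorter one
        bounds the distance in the induced subgraph.\<close>
      have le: "graph_dist (induced_edges E W) (c i) (c j) \<le> graph_dist E (c i) (c j)
          \<and> graph_dist (induced_edges E W) (c j) (c i) \<le> graph_dist E (c j) (c i)" if "i \<le> j" "j < n" for i j
      proof -
        have "(c i, c j) \<in> induced_edges E W ^^ (j - i)"
          using walk_relpow[of c, OF step, of i "j - i"] that by simp
        moreover have "(c j, c i) \<in> induced_edges E W ^^ (n - (j - i))"
          using walk_relpow[of c, OF step, of j "n - (j - i)"] that per[of i] by (simp add: add.commute)
        ultimately have "(c i, c j) \<in> induced_edges E W ^^ min (j - i) (n - (j - i))"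
          using sym_relpow[OF symF] by (auto simp: min_def)
        moreover from this have "(c j, c i) \<in> induced_edges E W ^^ min (j - i) (n - (j - i))"
          by (rule sym_relpow[OF symF])
        ultimately show ?thesis
          using graph_dist_le dist[OF that] d_sym[of "c i" "c j"]
          by (auto simp: graph_dist_total_dist[OF conn cV cV])
      qed
      fix u v
      assume "u \<in> W" "v \<in> W"
      then obtain i j where "u = c i" "v = c j" "i < n" "j < n" by (auto simp: W_def)
      then have "graph_dist (induced_edges E W) u v \<le> graph_dist E u v"
        using le[of i j] le[of j i] by (cases "i \<le> j") auto
      moreover have "graph_dist E u v \<le> graph_dist (induced_edges E W) u v"
        by (rule graph_dist_mono) (simp add: induced_edges_def)
      ultimately show "graph_dist (induced_edges E W) u v = graph_dist E u v" by simp
    qed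
    ultimately show False using bridged n unfolding bridged_graph_def by blast
  qed
qed

theorem proposition7p5:
  fixes X :: "'a set set"
  assumes "round_systolic_complex X"
  shows "complex_diameter X \<le> 2"
proof (rule ccontr)
  assume large: "\<not> complex_diameter X \<le> 2"
  define V where "V = vertices X"
  define E where "E = skeleton_edges X"
  obtain k where k: "graph_diameter V E = enat k"
    and empty: "(\<Inter>v\<in>V. graph_ball V E (int k - 1) v) = {}"
    using assms by (auto simp: round_systolic_complex_def complex_diameter_def complex_ball_def V_def E_def)
  have bridged: "bridged_graph V E" and simplicial: "simplicial_complex X" and flag: "flag_complex X"
    using assms by (auto simp: round_systolic_complex_def systolic_complex_def V_def E_def)
  have conn: "connected_graph V E" using bridged by (simp add: bridged_graph_def)
  let ?d = "total_dist V E"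
  interpret bridged_metric V ?d by (rule bridged_metric_total_dist[OF bridged])
  have "\<not> enat k \<le> enat 2"
    using large k by (simp add: complex_diameter_def V_def E_def numeral_eq_enat)
  then have k3: "3 \<le> k" by simp
  have bound: "?d x y \<le> k" for x y
  proof -
    have "graph_dist E (retract V x) (retract V y) \<le> (SUP v\<in>V. graph_dist E (retract V x) v)"
      by (rule SUP_upper) (rule retract_in[OF conn])
    also have "\<dots> \<le> graph_diameter V E"
      unfolding graph_diameter_def by (rule SUP_upper) (rule retract_in[OF conn])
    finally have "graph_dist E (retract V x) (retract V y) \<le> graph_diameter V E" .
    then show ?thesis
      using k retract_in[OF conn] by (simp add: graph_dist_total_dist[OF conn] total_dist_retract[OF conn])
  qed
  \<comment> \<open>Flagness applies to infinite sets as well: \<open>Q\<close> lies in a simplex,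
    and simplices are finite.\<close>
  have cliques: "finite Q" if Q: "Q \<subseteq> V" "\<And>x y. x \<in> Q \<Longrightarrow> y \<in> Q \<Longrightarrow> ?d x y \<le> 1" for Q
  proof -
    have "\<exists>\<sigma>\<in>X. {u, v} \<subseteq> \<sigma>" if uv: "u \<in> Q" "v \<in> Q" for u v
    proof -
      have "?d u v = 0 \<or> ?d u v = 1" using Q(2)[OF uv] by linarith
      then have "u = v \<or> (u, v) \<in> E"
        using total_dist_eq_0[OF conn, of u v] total_dist_eq_1[OF conn, of u v] uv Q by auto
      then show ?thesis using uv Q by (auto simp: E_def skeleton_edges_def V_def vertices_def)
    qed
    then have "\<exists>\<sigma>\<in>X. Q \<subseteq> \<sigma>"
      using flag[unfolded flag_complex_def, rule_format, of Q] Q(1) by (simp add: V_def)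
    then obtain \<sigma> where \<sigma>: "\<sigma> \<in> X" "Q \<subseteq> \<sigma>" by blast
    moreover from \<sigma> have "finite \<sigma>" using simplicial by (simp add: simplicial_complex_def)
    ultimately show ?thesis using finite_subset by blast
  qed
  obtain x where x: "\<And>v. ?d v x < k" using antipodes_center[OF k3 bound cliques] by blast
  \<comment> \<open>The point \<open>x\<close> may lie outside \<open>V\<close>, but its retract has
    the same distances.\<close>
  have "retract V x \<in> graph_ball V E (int k - 1) v" if "v \<in> V" for v
    using that x[of v] retract_in[OF conn] total_dist_retract[OF conn, of v x]
    by (auto simp: graph_ball_def graph_dist_total_dist[OF conn] retract_def)
  with empty show False by blast
qed

end
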